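(* Let $h:\mathrm{St}(r,n,\mathbb{C})\to\mathbb{R}$ be a $C^2$ scale invariant function and let $U$ be a stationary point of $h$. For $1\le p\le r$ let $\Omega_p=\mathrm{i}\,e_pe_p^{T}\in\mathbb{C}^{r\times r}$ and $Z_p=U\Omega_p\in\mathbf{T}_U\mathrm{St}(r,n,\mathbb{C})$. Then $\mathrm{Hess}\,h(U)[Z_p]=0$ for all $1\le p\le r$. In particular, $\mathrm{rank}\,\mathrm{Hess}\,h(U)\le 2nr-r^2-r$.
   Context: For $1\le r\le n$, $\mathrm{St}(r,n,\mathbb{C})=\{X\in\mathbb{C}^{n\times r}:X^{H}X=I_r\}$, viewed as a Riemannian submanifold (of real dimension $2nr-r^2$) of the real Euclidean space $\mathbb{C}^{n\times r}$ with inner product $\langle X,Y\rangle_{\Re}=\Re\,\mathrm{tr}(X^{H}Y)$. $\mathbf{T}_U\mathrm{St}(r,n,\mathbb{C})$ is the tangent space at $U$. $U$ is a stationary point of $h$ if the Riemannian gradient of $h$ vanishes at $U$. $\mathrm{Hess}\,h(U)$ is the Riemannian Hessian, a real-linear self-map of $\mathbf{T}_U\mathrm{St}(r,n,\mathbb{C})$; rank means real rank. $h$ is scale invariant if $h(UR)=h(U)$ for all $U$ and all diagonal matrices $R\in\mathbb{C}^{r\times r}$ with unimodular diagonal entries. $e_p$ is the $p$-th standard unit vector and $\mathrm{i}$ the imaginary unit. *)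

theory Defs
  imports "HOL-Analysis.Analysis"
begin

text \<open>
  Riemannian notions for an embedded submanifold \<open>M\<close> of a Euclidean space, with the metric
  inherited from the ambient inner product. A real-valued function on \<open>M\<close> is represented by a
  total function on the ambient space; everything below only depends on its values on \<open>M\<close>.
\<close>

definition curve_in :: "'a::euclidean_space set \<Rightarrow> 'a \<Rightarrow> (real \<Rightarrow> 'a) \<Rightarrow> 'a \<Rightarrow> bool" where
  "curve_in M x c v \<longleftrightarrow>
     (\<exists>e>0. c C1_differentiable_on {-e<..<e} \<and> c ` {-e<..<e} \<subseteq> M) \<and>
     c 0 = x \<and> (c has_vector_derivative v) (at 0)"

definition tangent_space :: "'a::euclidean_space set \<Rightarrow> 'a \<Rightarrow> 'a set" where
  "tangent_space M x = {v. \<exists>c. curve_in M x c v}"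

definition C2_on :: "('a::euclidean_space \<Rightarrow> real) \<Rightarrow> 'a set \<Rightarrow> bool" where
  "C2_on f W \<longleftrightarrow>
     (\<exists>(f' :: 'a \<Rightarrow> 'a \<Rightarrow>\<^sub>L real) (f'' :: 'a \<Rightarrow> 'a \<Rightarrow>\<^sub>L ('a \<Rightarrow>\<^sub>L real)).
        (\<forall>x\<in>W. (f has_derivative blinfun_apply (f' x)) (at x)) \<and>
        (\<forall>x\<in>W. (f' has_derivative blinfun_apply (f'' x)) (at x)) \<and>
        continuous_on W f'')"

definition C2_on_submanifold :: "('a::euclidean_space \<Rightarrow> real) \<Rightarrow> 'a set \<Rightarrow> bool" where
  "C2_on_submanifold h M \<longleftrightarrow>
     (\<forall>x\<in>M. \<exists>W f. open W \<and> x \<in> W \<and> C2_on f W \<and> (\<forall>y\<in>W \<inter> M. f y = h y))"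

text \<open>
  The Riemannian gradient represents the differential \<open>v \<mapsto> (h \<circ> c)'(0)\<close>, where \<open>c\<close> is a curve
  in \<open>M\<close> through \<open>x\<close> with velocity \<open>v\<close>.
\<close>

definition riem_grad :: "'a::euclidean_space set \<Rightarrow> ('a \<Rightarrow> real) \<Rightarrow> 'a \<Rightarrow> 'a" where
  "riem_grad M h x = (THE g. g \<in> tangent_space M x \<and>
     (\<forall>c v. curve_in M x c v \<longrightarrow>
        ((\<lambda>t. h (c t)) has_real_derivative (g \<bullet> v)) (at 0)))"

definition stationary_point :: "'a::euclidean_space set \<Rightarrow> ('a \<Rightarrow> real) \<Rightarrow> 'a \<Rightarrow> bool" where
  "stationary_point M h x \<longleftrightarrow> x \<in> M \<and> riem_grad M h x = 0"

text \<open>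
  The Riemannian Hessian \<open>v \<mapsto> \<nabla>\<^sub>v grad h\<close>. The Levi-Civita connection of a submanifold is the
  tangential part of the ambient derivative, so the value at a tangent vector \<open>v\<close> is the
  orthogonal projection onto the tangent space at \<open>x\<close> of the derivative \<open>d\<close> of \<open>grad h\<close> along any
  curve in \<open>M\<close> through \<open>x\<close> with velocity \<open>v\<close>. It is only meaningful for tangent \<open>v\<close>.
\<close>

definition riem_hess :: "'a::euclidean_space set \<Rightarrow> ('a \<Rightarrow> real) \<Rightarrow> 'a \<Rightarrow> 'a \<Rightarrow> 'a" where
  "riem_hess M h x v = (THE w. w \<in> tangent_space M x \<and>
     (\<forall>c. curve_in M x c v \<longrightarrow>
        (\<exists>d. ((\<lambda>t. riem_grad M h (c t)) has_vector_derivative d) (at 0) \<and>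
             (\<forall>u\<in>tangent_space M x. (d - w) \<bullet> u = 0))))"

text \<open>Real rank of the Hessian as a real-linear self-map of the tangent space.\<close>

definition riem_hess_rank :: "'a::euclidean_space set \<Rightarrow> ('a \<Rightarrow> real) \<Rightarrow> 'a \<Rightarrow> nat" where
  "riem_hess_rank M h x = dim (riem_hess M h x ` tangent_space M x)"

text \<open>
  Complex \<open>n \<times> r\<close> matrices have type \<^typ>\<open>complex^'r^'n\<close>; the inner product of this type is
  \<open>Re (tr (X\<^sup>H Y))\<close>, see \<open>inner_eq_Re_trace\<close>.
\<close>

definition ctranspose :: "complex^'r^'n \<Rightarrow> complex^'n^'r" where
  "ctranspose X = (\<chi> i j. cnj (X $ j $ i))"

lemma inner_eq_Re_trace:
  fixes X Y :: "complex^'r^'n"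
  shows "X \<bullet> Y = Re (trace (ctranspose X ** Y))"
proof -
  have "X \<bullet> Y = (\<Sum>i\<in>UNIV. \<Sum>j\<in>UNIV. Re (cnj (X $ i $ j) * Y $ i $ j))"
    by (simp add: inner_vec_def inner_complex_def)
  also have "\<dots> = (\<Sum>j\<in>UNIV. \<Sum>i\<in>UNIV. Re (cnj (X $ i $ j) * Y $ i $ j))"
    by (rule sum.swap)
  also have "\<dots> = Re (trace (ctranspose X ** Y))"
    by (simp add: trace_def ctranspose_def matrix_matrix_mult_def)
  finally show ?thesis .
qed

definition Stiefel :: "(complex^'r^'n) set" where
  "Stiefel = {X. ctranspose X ** X = mat 1}"

definition unimodular_diagonal :: "complex^'r^'r \<Rightarrow> bool" where
  "unimodular_diagonal R \<longleftrightarrow>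
     (\<forall>i j. i \<noteq> j \<longrightarrow> R $ i $ j = 0) \<and> (\<forall>i. cmod (R $ i $ i) = 1)"

definition scale_invariant :: "(complex^'r^'n \<Rightarrow> real) \<Rightarrow> bool" where
  "scale_invariant h \<longleftrightarrow>
     (\<forall>U\<in>Stiefel. \<forall>R. unimodular_diagonal R \<longrightarrow> h (U ** R) = h U)"

text \<open>\<open>\<Omega>\<^sub>p = \<i> e\<^sub>p e\<^sub>p\<^sup>T\<close>, where \<open>e\<^sub>p\<close> is \<open>axis p 1\<close>.\<close>

definition Omega :: "'r \<Rightarrow> complex^'r^'r" where
  "Omega p = (\<chi> j k. \<i> * (axis p 1 $ j * axis p 1 $ k))"

end

theory Submission
  imports Defs
begin

text \<open>
  Why the theorem is true. Multiplying column \<open>p\<close> of \<open>U\<close> by \<open>exp (\<i> t)\<close> gives a curve in the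
  Stiefel manifold with velocity \<open>U \<Omega>\<^sub>p\<close>. Right multiplication by a unimodular diagonal matrix is an
  isometry of the manifold that preserves \<open>h\<close>, so it carries stationary points to stationary points
  (\<open>riem_grad_vanishes_on_orbit\<close>). The gradient is thus zero along the whole curve, and the Hessian,
  which is the projected derivative of the gradient along any curve with the given velocity,
  vanishes at \<open>U \<Omega>\<^sub>p\<close>.

  For the rank, the \<open>U \<Omega>\<^sub>p\<close> are orthonormal, so the kernel of the Hessian has dimension at least \<open>r\<close>.
  The tangent space has dimension at most \<open>2 n r - r\<^sup>2\<close>, because it is orthogonal to the space of all
  \<open>U S\<close> with \<open>S\<close> Hermitian, whose dimension is at least \<open>r\<^sup>2\<close>. Rank and nullity add up.

  Gradient and Hessian are definite descriptions that quantify over curves, and most of the work is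
  to evaluate them. A description of this kind determines a vector only if there are enough curves:
  the set of velocities must be a subspace. \<open>tangent_space_Stiefel\<close> identifies it with
  \<open>{Z. U\<^sup>H Z is skew-Hermitian}\<close>, where Cayley transforms of skew-Hermitian matrices provide a curve for
  each such \<open>Z\<close>. The orthogonal projection onto this subspace is polynomial in \<open>U\<close>, so the Riemannian
  gradient is locally the restriction of an ambient differentiable map, namely the projected
  gradient of a \<open>C\<^sup>2\<close> extension of \<open>h\<close>. That makes the Hessian linear on the tangent space
  (\<open>riem_hess_Stiefel_linear\<close>), as counting dimensions requires.
\<close>

section \<open>Gradients and Hessians on submanifolds\<close>

lemma curve_in_eventually:
  assumes "curve_in M x c v" "open W" "x \<in> W"
  shows "\<forall>\<^sub>F t in nhds 0. c t \<in> W \<inter> M"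
proof -
  obtain e where e: "e > 0" "c ` {-e<..<e} \<subseteq> M" and c: "c 0 = x"
    "(c has_vector_derivative v) (at 0)"
    using assms(1) by (auto simp: curve_in_def)
  have "\<forall>\<^sub>F t in nhds 0. t \<in> {-e<..<e}"
    using e by (intro eventually_nhds_in_open) auto
  moreover have "isCont c 0"
    using c(2) has_vector_derivative_continuous by blast
  then have "filterlim c (nhds x) (nhds 0)"
    using c(1) unfolding isCont_def tendsto_at_iff_tendsto_nhds by simp
  then have "\<forall>\<^sub>F t in nhds 0. c t \<in> W"
    using assms(2,3) by (rule topological_tendstoD)
  ultimately show ?thesis
    by eventually_elim (use e(2) in auto)
qed

lemma has_vector_derivative_along_curve:
  fixes H F :: "'a::euclidean_space \<Rightarrow> 'b::real_normed_vector"
  assumes "curve_in M x c v" "open W" "x \<in> W"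
    and HF: "\<And>y. y \<in> W \<inter> M \<Longrightarrow> H y = F y"
    and F: "(F has_derivative F') (at x)"
  shows "((\<lambda>t. H (c t)) has_vector_derivative F' v) (at 0)"
proof -
  have c: "c 0 = x" "(c has_vector_derivative v) (at 0)"
    using assms(1) by (auto simp: curve_in_def)
  have "((F \<circ> c) has_vector_derivative F' v) (at 0)"
    using c F by (intro vector_derivative_diff_chain_within)
      (auto intro: has_derivative_at_withinI)
  moreover have ev: "\<forall>\<^sub>F t in nhds 0. (F \<circ> c) t = H (c t)"
    using curve_in_eventually[OF assms(1-3)] by eventually_elim (simp add: HF)
  ultimately show ?thesis
    using has_vector_derivative_cong_ev[of UNIV "F \<circ> c" "\<lambda>t. H (c t)" 0 "F' v"]
      eventually_nhds_x_imp_x[OF ev] by simp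
qed

text \<open>
  Uniqueness is the point: in a subspace, the difference of two candidate gradients is again the
  velocity of a curve, and comparing both derivatives along this curve shows that the difference is
  orthogonal to itself.
\<close>

lemma riem_gradI:
  assumes T: "subspace (tangent_space M x)" and g: "g \<in> tangent_space M x"
    and D: "\<And>c v. curve_in M x c v \<Longrightarrow>
      ((\<lambda>t. h (c t)) has_real_derivative g \<bullet> v) (at 0)"
  shows "riem_grad M h x = g"
  unfolding riem_grad_def
proof (rule the_equality)
  fix g'
  assume g': "g' \<in> tangent_space M x \<and> (\<forall>c v. curve_in M x c v \<longrightarrow>
      ((\<lambda>t. h (c t)) has_real_derivative g' \<bullet> v) (at 0))"
  then have "g' - g \<in> tangent_space M x"
    using T g by (simp add: subspace_diff)
  then obtain c where c: "curve_in M x c (g' - g)"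
    by (auto simp: tangent_space_def)
  have "g' \<bullet> (g' - g) = g \<bullet> (g' - g)"
    using DERIV_unique D[OF c] g' c by blast
  then have "(g' - g) \<bullet> (g' - g) = 0"
    by (simp add: inner_diff_left)
  then show "g' = g"
    by simp
qed (use g D in auto)

text \<open>
  The hypothesis on \<open>F\<close> says that the gradient field extends locally to an ambient map that is
  differentiable at \<open>x\<close>. Its derivative along a curve then depends only on the velocity of the curve,
  which is what makes the Hessian well defined.
\<close>

lemma riem_hessI:
  assumes T: "subspace (tangent_space M x)" and v: "v \<in> tangent_space M x"
    and W: "open W" "x \<in> W"
    and F: "\<And>y. y \<in> W \<inter> M \<Longrightarrow> riem_grad M h y = F y" "(F has_derivative D) (at x)"
    and w: "w \<in> tangent_space M x" "\<And>u. u \<in> tangent_space M x \<Longrightarrow> (D v - w) \<bullet> u = 0"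
  shows "riem_hess M h x v = w"
  unfolding riem_hess_def
proof (rule the_equality)
  have D: "((\<lambda>t. riem_grad M h (c t)) has_vector_derivative D v) (at 0)"
    if "curve_in M x c v" for c
    using that W F by (rule has_vector_derivative_along_curve)
  then show "w \<in> tangent_space M x \<and> (\<forall>c. curve_in M x c v \<longrightarrow>
      (\<exists>d. ((\<lambda>t. riem_grad M h (c t)) has_vector_derivative d) (at 0) \<and>
        (\<forall>u\<in>tangent_space M x. (d - w) \<bullet> u = 0)))"
    using w by blast
  fix w'
  assume w': "w' \<in> tangent_space M x \<and> (\<forall>c. curve_in M x c v \<longrightarrow>
      (\<exists>d. ((\<lambda>t. riem_grad M h (c t)) has_vector_derivative d) (at 0) \<and>
        (\<forall>u\<in>tangent_space M x. (d - w') \<bullet> u = 0)))"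
  obtain c where c: "curve_in M x c v"
    using v by (auto simp: tangent_space_def)
  obtain d where d: "((\<lambda>t. riem_grad M h (c t)) has_vector_derivative d) (at 0)"
    "\<forall>u\<in>tangent_space M x. (d - w') \<bullet> u = 0"
    using w' c by blast
  have "d = D v"
    using d(1) D[OF c] by (rule vector_derivative_unique_at)
  moreover have "w' - w \<in> tangent_space M x"
    using T w w' by (simp add: subspace_diff)
  ultimately have "(D v - w) \<bullet> (w' - w) - (D v - w') \<bullet> (w' - w) = 0"
    using d(2) w(2) by simp
  then have "(w' - w) \<bullet> (w' - w) = 0"
    by (simp add: inner_diff_left)
  then show "w' = w"
    by simp
qed

section \<open>Complex matrices as a real inner product space\<close>

interpretation matrix_mult: bounded_bilinear
  "(**) :: complex^'m^'n \<Rightarrow> complex^'p^'m \<Rightarrow> complex^'p^'n"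
proof -
  have "bilinear ((**) :: complex^'m^'n \<Rightarrow> complex^'p^'m \<Rightarrow> complex^'p^'n)"
    unfolding bilinear_def
    by (auto intro!: linearI simp: matrix_matrix_mult_def vec_eq_iff sum.distrib
        algebra_simps scaleR_sum_right)
  then show "bounded_bilinear ((**) :: complex^'m^'n \<Rightarrow> complex^'p^'m \<Rightarrow> complex^'p^'n)"
    by (simp add: bilinear_conv_bounded_bilinear)
qed

lemmas matrix_mult_linear =
  matrix_mult.add_left matrix_mult.add_right matrix_mult.diff_left matrix_mult.diff_right
  matrix_mult.scaleR_left matrix_mult.scaleR_right matrix_mult.minus_left matrix_mult.minus_right

lemma bounded_linear_ctranspose: "bounded_linear ctranspose"
  by (intro linear_conv_bounded_linear[THEN iffD1] linearI)
    (auto simp: ctranspose_def vec_eq_iff)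

lemmas ctranspose_linear =
  linear_add[OF bounded_linear.linear[OF bounded_linear_ctranspose]]
  linear_diff[OF bounded_linear.linear[OF bounded_linear_ctranspose]]
  linear_scale[OF bounded_linear.linear[OF bounded_linear_ctranspose]]
  linear_neg[OF bounded_linear.linear[OF bounded_linear_ctranspose]]
  linear_0[OF bounded_linear.linear[OF bounded_linear_ctranspose]]

lemma ctranspose_ctranspose [simp]: "ctranspose (ctranspose X) = X"
  by (simp add: ctranspose_def vec_eq_iff)

lemma ctranspose_mat_1 [simp]: "ctranspose (mat 1) = mat 1"
  by (simp add: ctranspose_def vec_eq_iff mat_def)

lemma ctranspose_mult: "ctranspose (X ** Y) = ctranspose Y ** ctranspose X"
  by (simp add: ctranspose_def vec_eq_iff matrix_matrix_mult_def mult.commute)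

lemma inner_ctranspose: "ctranspose X \<bullet> ctranspose Y = X \<bullet> Y"
proof -
  have "ctranspose X \<bullet> ctranspose Y = (\<Sum>i\<in>UNIV. \<Sum>j\<in>UNIV. X $ j $ i \<bullet> Y $ j $ i)"
    by (simp add: inner_vec_def ctranspose_def inner_complex_def)
  also have "\<dots> = X \<bullet> Y"
    by (subst sum.swap) (simp add: inner_vec_def)
  finally show ?thesis .
qed

lemma inner_matrix_mult_left: "(A ** X) \<bullet> Y = X \<bullet> (ctranspose A ** Y)"
  by (simp add: inner_eq_Re_trace ctranspose_mult matrix_mul_assoc)

text \<open>
  Conjugate transposition is an isometry, so its eigenspaces for \<open>1\<close> and \<open>-1\<close> are orthogonal.
\<close>

lemma inner_hermitian_skew:
  assumes "ctranspose S = S" "ctranspose K = - K"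
  shows "S \<bullet> K = 0"
  using inner_ctranspose[of S K] assms by simp

section \<open>The Cayley transform\<close>

text \<open>
  For skew-Hermitian \<open>A\<close> and \<open>R t = (1 - t A)\<^sup>-\<^sup>1\<close>, the Cayley transform
  \<open>(1 + t A) (1 - t A)\<^sup>-\<^sup>1 = 2 R t - 1\<close> is a curve of unitary matrices with velocity \<open>2 A\<close> at \<open>0\<close>.
  It is studied through the resolvent \<open>R\<close>.
\<close>

definition cayley_resolvent :: "complex^'n^'n \<Rightarrow> real \<Rightarrow> complex^'n^'n" where
  "cayley_resolvent A t = matrix_inv (mat 1 - t *\<^sub>R A)"

context
  fixes A :: "complex^'n^'n"
  assumes skew: "ctranspose A = - A"
begin

text \<open>
  If \<open>X = t A X\<close>, then \<open>X\<close> is orthogonal to itself, because \<open>A X\<close> is orthogonal to \<open>X\<close> for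
  skew-Hermitian \<open>A\<close>.
\<close>

lemma invertible_one_minus_skew: "invertible (mat 1 - t *\<^sub>R A)"
proof -
  define L where "L X = (mat 1 - t *\<^sub>R A) ** X" for X :: "complex^'n^'n"
  have "linear L"
    unfolding L_def by (simp add: matrix_mult.bounded_linear_right bounded_linear.linear)
  moreover have "X = 0" if "L X = 0" for X
  proof -
    have X: "X = t *\<^sub>R (A ** X)"
      using that by (simp add: L_def matrix_mult_linear)
    have "(A ** X) \<bullet> X = 0"
      using inner_matrix_mult_left[of A X X] by (simp add: skew matrix_mult_linear inner_commute)
    then have "X \<bullet> X = 0"
      by (subst X) simp
    then show ?thesis by simp
  qed
  then have "inj L"
    using \<open>linear L\<close> linear_injective_0 by blast
  ultimately have "surj L"
    by (simp add: linear_injective_imp_surjective)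
  then obtain B where "L B = mat 1"
    by (metis surjD)
  then show ?thesis
    by (auto simp: L_def invertible_right_inverse)
qed

lemma cayley_resolvent_inverse:
  "cayley_resolvent A t ** (mat 1 - t *\<^sub>R A) = mat 1"
  "(mat 1 - t *\<^sub>R A) ** cayley_resolvent A t = mat 1"
  using invertible_one_minus_skew[of t]
    someI_ex[of "\<lambda>B. (mat 1 - t *\<^sub>R A) ** B = mat 1 \<and> B ** (mat 1 - t *\<^sub>R A) = mat 1"]
  unfolding cayley_resolvent_def matrix_inv_def invertible_def by auto

lemma cayley_resolvent_0 [simp]: "cayley_resolvent A 0 = mat 1"
  using cayley_resolvent_inverse(1)[of 0] by simp

text \<open>
  This identity says exactly that \<open>2 R t - 1\<close> is unitary. It follows by writing the middle factor \<open>2\<close> of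
  \<open>R\<^sup>H 2 R\<close> as \<open>(1 + t A) + (1 - t A)\<close>.
\<close>

lemma cayley_resolvent_gram:
  "2 *\<^sub>R (ctranspose (cayley_resolvent A t) ** cayley_resolvent A t) =
    cayley_resolvent A t + ctranspose (cayley_resolvent A t)"
proof -
  let ?R = "cayley_resolvent A t"
  have "ctranspose ((mat 1 - t *\<^sub>R A) ** ?R) = mat 1"
    by (simp add: cayley_resolvent_inverse)
  then have l: "ctranspose ?R ** (mat 1 + t *\<^sub>R A) = mat 1"
    by (simp add: ctranspose_mult ctranspose_linear skew)
  have "2 *\<^sub>R (ctranspose ?R ** ?R)
      = (ctranspose ?R ** (mat 1 + t *\<^sub>R A)) ** ?R + ctranspose ?R ** ((mat 1 - t *\<^sub>R A) ** ?R)"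
    by (simp add: matrix_mult_linear matrix_mul_assoc scaleR_2)
  also have "\<dots> = ?R + ctranspose ?R"
    by (simp add: l cayley_resolvent_inverse)
  finally show ?thesis .
qed

text \<open>
  Taking the trace of the preceding identity gives \<open>R \<bullet> R = 1 \<bullet> R\<close>, and the Cauchy-Schwarz
  inequality does the rest. The bound is uniform in \<open>t\<close>, which turns the resolvent identity below into
  Lipschitz continuity of \<open>R\<close>.
\<close>

lemma norm_cayley_resolvent_le:
  "norm (cayley_resolvent A t) \<le> norm (mat 1 :: complex^'n^'n)"
proof -
  let ?R = "cayley_resolvent A t" and ?I = "mat 1 :: complex^'n^'n"
  have "2 * (?R \<bullet> ?R) = ?I \<bullet> (2 *\<^sub>R (ctranspose ?R ** ?R))"
    using inner_matrix_mult_left[of ?R ?I ?R] by simp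
  also have "\<dots> = ?I \<bullet> ?R + ?I \<bullet> ctranspose ?R"
    by (simp only: cayley_resolvent_gram inner_add_right)
  also have "\<dots> = 2 * (?I \<bullet> ?R)"
    using inner_ctranspose[of ?I ?R] by simp
  also have "\<dots> \<le> 2 * (norm ?I * norm ?R)"
    by (simp add: norm_cauchy_schwarz)
  finally have "norm ?R * norm ?R \<le> norm ?I * norm ?R"
    by (simp add: power2_norm_eq_inner[symmetric] power2_eq_square)
  then show ?thesis
    by (metis mult_le_cancel_right norm_ge_zero less_eq_real_def norm_eq_zero)
qed

lemma cayley_resolvent_diff:
  "cayley_resolvent A t - cayley_resolvent A s =
    (t - s) *\<^sub>R (cayley_resolvent A t ** A ** cayley_resolvent A s)"
proof -
  let ?R = "cayley_resolvent A"
  have "?R t ** ((mat 1 - s *\<^sub>R A) ** ?R s) - (?R t ** (mat 1 - t *\<^sub>R A)) ** ?R s =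
      (t - s) *\<^sub>R (?R t ** A ** ?R s)"
    by (simp add: matrix_mult_linear matrix_mul_assoc algebra_simps)
  then show ?thesis
    by (simp add: cayley_resolvent_inverse)
qed

lemma continuous_cayley_resolvent: "continuous_on UNIV (cayley_resolvent A)"
proof -
  let ?R = "cayley_resolvent A"
  obtain K where K: "\<And>(X :: complex^'n^'n) (Y :: complex^'n^'n). norm (X ** Y) \<le> norm X * norm Y * K" "K > 0"
    using matrix_mult.pos_bounded by blast
  define C where "C = norm (mat 1 :: complex^'n^'n)"
  have "norm (?R t - ?R s) \<le> (C * norm A * K * C * K) * norm (t - s)" for s t
  proof -
    have "norm (?R t ** A ** ?R s) \<le> norm (?R t ** A) * norm (?R s) * K"
      by (rule K(1))
    also have "\<dots> \<le> (norm (?R t) * norm A * K) * norm (?R s) * K"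
      using K(2) by (intro mult_right_mono K(1)) auto
    also have "\<dots> \<le> (C * norm A * K) * C * K"
      using K(2) norm_cayley_resolvent_le
      by (intro mult_mono) (auto simp: C_def)
    finally show ?thesis
      by (simp add: cayley_resolvent_diff mult.commute mult_left_mono)
  qed
  then show ?thesis
    by (intro lipschitz_on_continuous_on[of "C * norm A * K * C * K"] lipschitz_onI)
      (use K in \<open>auto simp: dist_norm C_def\<close>)
qed

text \<open>
  By the resolvent identity the difference quotient at \<open>s\<close> is \<open>R t A R s\<close>, so continuity of \<open>R\<close> is
  enough.
\<close>

lemma has_vector_derivative_cayley_resolvent:
  "(cayley_resolvent A has_vector_derivative cayley_resolvent A s ** A ** cayley_resolvent A s) (at s)"
proof -
  let ?R = "cayley_resolvent A"
  have "?R \<midarrow>s\<rightarrow> ?R s"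
    using continuous_cayley_resolvent by (simp add: continuous_on_eq_continuous_at isCont_def)
  then have "(\<lambda>t. norm (?R t ** A ** ?R s - ?R s ** A ** ?R s)) \<midarrow>s\<rightarrow>
      norm (?R s ** A ** ?R s - ?R s ** A ** ?R s)"
    by (intro tendsto_norm tendsto_diff matrix_mult.tendsto tendsto_const)
  moreover have "norm (?R t ** A ** ?R s - ?R s ** A ** ?R s) =
      norm (?R t - ?R s - (t - s) *\<^sub>R (?R s ** A ** ?R s)) / norm (t - s)" if "t \<noteq> s" for t
    using that by (simp add: cayley_resolvent_diff flip: scaleR_diff_right)
  ultimately have "(\<lambda>t. norm (?R t - ?R s - (t - s) *\<^sub>R (?R s ** A ** ?R s)) / norm (t - s))
      \<midarrow>s\<rightarrow> 0"
    by (subst (asm) LIM_equal) auto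
  then show ?thesis
    unfolding has_vector_derivative_def has_derivative_iff_norm
    by (simp add: bounded_linear_scaleR_left)
qed

end


section \<open>The tangent spaces of the Stiefel manifold\<close>

text \<open>
  The solutions \<open>Z\<close> of the linearisation \<open>X\<^sup>H Z + Z\<^sup>H X = 0\<close> of the defining equation \<open>X\<^sup>H X = 1\<close>.
\<close>

definition stiefel_tangent :: "complex^'r^'n \<Rightarrow> (complex^'r^'n) set" where
  "stiefel_tangent X = {Z. ctranspose (ctranspose X ** Z) = - (ctranspose X ** Z)}"

lemma StiefelD: "X \<in> Stiefel \<Longrightarrow> ctranspose X ** X = mat 1"
  by (simp add: Stiefel_def)

lemma subspace_stiefel_tangent: "subspace (stiefel_tangent X)"
  by (auto simp: subspace_def stiefel_tangent_def matrix_mult_linear ctranspose_linear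
      matrix_mult.zero_right)

lemma mult_unitary_in_Stiefel:
  assumes "X \<in> Stiefel" "ctranspose Q ** Q = mat 1"
  shows "X ** Q \<in> Stiefel"
proof -
  have "ctranspose (X ** Q) ** (X ** Q) = ctranspose Q ** (ctranspose X ** X) ** Q"
    by (simp add: ctranspose_mult matrix_mul_assoc)
  then show ?thesis
    using assms by (simp add: Stiefel_def)
qed

lemma unitary_mult_in_Stiefel:
  assumes "X \<in> Stiefel" "ctranspose Q ** Q = mat 1"
  shows "Q ** X \<in> Stiefel"
proof -
  have "ctranspose (Q ** X) ** (Q ** X) = ctranspose X ** (ctranspose Q ** Q) ** X"
    by (simp add: ctranspose_mult matrix_mul_assoc)
  then show ?thesis
    using assms by (simp add: Stiefel_def)
qed

text \<open>
  The skew-Hermitian matrix \<open>Z X\<^sup>H - X Z\<^sup>H\<close> maps \<open>X\<close> to \<open>Z + X X\<^sup>H Z\<close> when \<open>X\<^sup>H Z\<close> is skew-Hermitian; the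
  excess \<open>X X\<^sup>H Z\<close> is removed by the skew-Hermitian correction \<open>X (X\<^sup>H Z) X\<^sup>H\<close>.
\<close>

lemma stiefel_tangent_eq_skew_mult:
  assumes X: "X \<in> Stiefel" and Z: "Z \<in> stiefel_tangent X"
  obtains A where "ctranspose A = - A" "A ** X = Z"
proof
  let ?H = "ctranspose X"
  define A where "A = Z ** ?H - X ** ctranspose Z - X ** (?H ** Z) ** ?H"
  have K: "ctranspose Z ** X = - (?H ** Z)"
    using Z by (simp add: stiefel_tangent_def ctranspose_mult)
  have "ctranspose A = X ** ctranspose Z - Z ** ?H - X ** (ctranspose Z ** X) ** ?H"
    by (simp add: A_def ctranspose_linear ctranspose_mult matrix_mul_assoc)
  then show "ctranspose A = - A"
    by (simp add: A_def K matrix_mult_linear)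
  have "A ** X = Z ** (?H ** X) - X ** (ctranspose Z ** X) - X ** (?H ** Z) ** (?H ** X)"
    by (simp add: A_def matrix_mult_linear matrix_mul_assoc)
  then show "A ** X = Z"
    by (simp add: K StiefelD[OF X] matrix_mult_linear)
qed

lemma cayley_curve_in_Stiefel:
  assumes X: "X \<in> Stiefel" and A: "ctranspose A = - A"
  shows "curve_in Stiefel X (\<lambda>t. (2 *\<^sub>R cayley_resolvent A t - mat 1) ** X) (2 *\<^sub>R (A ** X))"
proof -
  let ?R = "cayley_resolvent A"
  let ?Q = "\<lambda>t. 2 *\<^sub>R ?R t - mat 1"
  let ?c' = "\<lambda>s. 2 *\<^sub>R (?R s ** A ** ?R s) ** X"
  have "ctranspose (?Q t) ** ?Q t = mat 1" for t
    using cayley_resolvent_gram[OF A, of t]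
    by (simp add: ctranspose_linear matrix_mult_linear algebra_simps)
  then have mem: "?Q t ** X \<in> Stiefel" for t
    by (simp add: unitary_mult_in_Stiefel X)
  have der: "((\<lambda>t. ?Q t ** X) has_vector_derivative ?c' s) (at s)" for s
    by (rule bounded_linear.has_vector_derivative[OF matrix_mult.bounded_linear_left])
      (auto intro!: derivative_eq_intros has_vector_derivative_cayley_resolvent[OF A])
  have "continuous_on {-1<..<1} ?c'"
    by (intro matrix_mult.continuous_on continuous_intros
        continuous_on_subset[OF continuous_cayley_resolvent[OF A]] subset_UNIV)
  then have "(\<lambda>t. ?Q t ** X) C1_differentiable_on {-1<..<1}"
    using der unfolding C1_differentiable_on_def by (intro exI[of _ ?c']) simp
  moreover have "((\<lambda>t. ?Q t ** X) has_vector_derivative 2 *\<^sub>R (A ** X)) (at 0)"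
    using der[of 0] by (simp add: cayley_resolvent_0[OF A] matrix_mult_linear)
  ultimately show ?thesis
    unfolding curve_in_def using mem
    by (auto intro!: exI[of _ 1] simp: cayley_resolvent_0[OF A] scaleR_2)
qed

text \<open>
  Velocities satisfy the linearised equation because \<open>c\<^sup>H c\<close> is constant along a curve \<open>c\<close>. Conversely,
  a solution \<open>Z\<close> is the velocity of the Cayley curve for a skew-Hermitian \<open>A\<close> with \<open>A X = Z / 2\<close>; the
  factor compensates the velocity \<open>2 A\<close> of the Cayley transform.
\<close>

proposition tangent_space_Stiefel:
  assumes X: "X \<in> Stiefel"
  shows "tangent_space Stiefel X = stiefel_tangent X"
proof
  show "tangent_space Stiefel X \<subseteq> stiefel_tangent X"
  proof
    fix v assume "v \<in> tangent_space Stiefel X"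
    then obtain c where c: "curve_in Stiefel X c v"
      by (auto simp: tangent_space_def)
    then have c0: "c 0 = X" "(c has_vector_derivative v) (at 0)"
      by (auto simp: curve_in_def)
    have "((\<lambda>t. ctranspose (c t) ** c t) has_vector_derivative
        ctranspose (c 0) ** v + ctranspose v ** c 0) (at 0)"
      by (intro matrix_mult.has_vector_derivative c0
          bounded_linear.has_vector_derivative[OF bounded_linear_ctranspose])
    moreover have "\<forall>\<^sub>F t in nhds 0. ctranspose (c t) ** c t = mat 1"
      using curve_in_eventually[OF c open_UNIV UNIV_I]
      by eventually_elim (simp add: Stiefel_def)
    then have "((\<lambda>t. ctranspose (c t) ** c t) has_vector_derivative 0) (at 0)"
      by (subst has_vector_derivative_cong_ev[where g = "\<lambda>_. mat 1"])
        (auto elim: eventually_mono dest: eventually_nhds_x_imp_x)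
    ultimately have "ctranspose X ** v + ctranspose v ** X = 0"
      using c0 vector_derivative_unique_at by blast
    then show "v \<in> stiefel_tangent X"
      by (simp add: stiefel_tangent_def ctranspose_mult add_eq_0_iff)
  qed
  show "stiefel_tangent X \<subseteq> tangent_space Stiefel X"
  proof
    fix Z assume Z: "Z \<in> stiefel_tangent X"
    then have "(1/2) *\<^sub>R Z \<in> stiefel_tangent X"
      by (simp add: subspace_stiefel_tangent subspace_scale)
    then obtain A where "ctranspose A = - A" "A ** X = (1/2) *\<^sub>R Z"
      using stiefel_tangent_eq_skew_mult[OF X] by blast
    then show "Z \<in> tangent_space Stiefel X"
      using cayley_curve_in_Stiefel[OF X, of A] by (auto simp: tangent_space_def)
  qed
qed

lemma mult_hermitian_orthogonal_tangent:
  assumes "ctranspose S = S" "Z \<in> stiefel_tangent X"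
  shows "(X ** S) \<bullet> Z = 0"
proof -
  have "(X ** S) \<bullet> Z = S \<bullet> (ctranspose X ** Z)"
    by (rule inner_matrix_mult_left)
  then show ?thesis
    using assms inner_hermitian_skew by (simp add: stiefel_tangent_def)
qed

text \<open>
  The orthogonal projection onto the tangent space at \<open>X\<close>: it subtracts the normal component
  \<open>X S\<close>, where \<open>S\<close> is the Hermitian part of \<open>X\<^sup>H G\<close>. Off the manifold this is not a projection, but the
  formula makes sense there and is differentiable in \<open>X\<close>.
\<close>

definition stiefel_proj :: "complex^'r^'n \<Rightarrow> complex^'r^'n \<Rightarrow> complex^'r^'n" where
  "stiefel_proj X G = G - (1/2) *\<^sub>R (X ** (ctranspose X ** G + ctranspose G ** X))"

lemma stiefel_proj_in_tangent:
  assumes "X \<in> Stiefel"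
  shows "stiefel_proj X G \<in> stiefel_tangent X"
proof -
  let ?B = "ctranspose X ** G"
  have "ctranspose X ** stiefel_proj X G = ?B - (1/2) *\<^sub>R ((ctranspose X ** X) ** (?B + ctranspose ?B))"
    by (simp add: stiefel_proj_def matrix_mult_linear matrix_mul_assoc ctranspose_mult)
  also have "\<dots> = (1/2 + 1/2) *\<^sub>R ?B - (1/2) *\<^sub>R (?B + ctranspose ?B)"
    by (simp add: StiefelD[OF assms])
  also have "\<dots> = (1/2) *\<^sub>R (?B - ctranspose ?B)"
    by (simp only: scaleR_left_distrib scaleR_add_right scaleR_diff_right) simp
  finally show ?thesis
    by (simp add: stiefel_tangent_def ctranspose_linear flip: scaleR_minus_right)
qed

lemma stiefel_proj_residual_orthogonal:
  assumes "Z \<in> stiefel_tangent X"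
  shows "(G - stiefel_proj X G) \<bullet> Z = 0"
proof -
  have "(X ** (ctranspose X ** G + ctranspose G ** X)) \<bullet> Z = 0"
    using assms by (intro mult_hermitian_orthogonal_tangent)
      (simp_all add: ctranspose_linear ctranspose_mult)
  then show ?thesis
    by (simp add: stiefel_proj_def)
qed

lemma linear_stiefel_proj: "linear (stiefel_proj X)"
proof (rule linearI)
  show "stiefel_proj X (G + H) = stiefel_proj X G + stiefel_proj X H" for G H
    by (simp add: stiefel_proj_def matrix_mult_linear ctranspose_linear scaleR_add_right)
  show "stiefel_proj X (r *\<^sub>R G) = r *\<^sub>R stiefel_proj X G" for r G
    by (simp add: stiefel_proj_def matrix_mult_linear ctranspose_linear scaleR_add_right
        scaleR_diff_right mult.commute)
qed

lemma has_derivative_stiefel_proj: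
  fixes G :: "complex^'r^'n \<Rightarrow> complex^'r^'n"
  assumes "(G has_derivative G') (at X)"
  shows "\<exists>D. ((\<lambda>Y. stiefel_proj Y (G Y)) has_derivative D) (at X)"
proof -
  let ?S = "\<lambda>Y. ctranspose Y ** G Y + ctranspose (G Y) ** Y"
  let ?S' = "\<lambda>V. (ctranspose X ** G' V + ctranspose V ** G X) +
    (ctranspose (G X) ** V + ctranspose (G' V) ** X)"
  have "((\<lambda>Y. ctranspose Y) has_derivative (\<lambda>V. ctranspose V)) (at X)"
    by (rule bounded_linear_imp_has_derivative[OF bounded_linear_ctranspose])
  moreover have "((\<lambda>Y. ctranspose (G Y)) has_derivative (\<lambda>V. ctranspose (G' V))) (at X)"
    by (rule bounded_linear.has_derivative[OF bounded_linear_ctranspose assms])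
  ultimately have S: "(?S has_derivative ?S') (at X)"
    by (intro has_derivative_add matrix_mult.FDERIV assms has_derivative_ident)
  have "((\<lambda>Y. G Y - (1/2) *\<^sub>R (Y ** ?S Y)) has_derivative
      (\<lambda>V. G' V - (1/2) *\<^sub>R (X ** ?S' V + V ** ?S X))) (at X)"
    by (intro has_derivative_diff has_derivative_scaleR_right matrix_mult.FDERIV assms S
        has_derivative_ident)
  then show ?thesis
    unfolding stiefel_proj_def by blast
qed

section \<open>The dimension of the tangent spaces\<close>

text \<open>
  Every square matrix is a sum of a Hermitian one and \<open>\<i>\<close> times a Hermitian one, so twice the
  dimension of the Hermitian matrices is at least \<open>2 r\<^sup>2\<close>.
\<close>

lemma dim_hermitian_ge:
  "CARD('r)^2 \<le> dim {S :: complex^'r^'r. ctranspose S = S}"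
proof -
  let ?H = "{S :: complex^'r^'r. ctranspose S = S}"
  define J where "J S = (\<chi> i j. \<i> * S $ i $ j)" for S :: "complex^'r^'r"
  have J: "linear J"
    by (intro linearI) (simp_all add: J_def vec_eq_iff algebra_simps)
  have sH: "subspace ?H"
    by (auto simp: subspace_def ctranspose_linear)
  have sJ: "subspace (J ` ?H)"
    using J sH by (rule linear_subspace_image)
  have "B \<in> {x + y |x y. x \<in> ?H \<and> y \<in> J ` ?H}" for B :: "complex^'r^'r"
  proof -
    define P where "P = (1/2) *\<^sub>R (B + ctranspose B)"
    define Q where "Q = - (1/2) *\<^sub>R J (B - ctranspose B)"
    have "P \<in> ?H" "Q \<in> ?H" "B = P + J Q"
      by (auto simp: P_def Q_def J_def ctranspose_def vec_eq_iff complex_eq_iff field_simps)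
    then show ?thesis by blast
  qed
  then have "{x + y |x y. x \<in> ?H \<and> y \<in> J ` ?H} = UNIV"
    by blast
  then have "DIM(complex^'r^'r) \<le> dim ?H + dim (J ` ?H)"
    using dim_sums_Int[OF sH sJ] by simp
  also have "\<dots> \<le> 2 * dim ?H"
    using dim_image_le[OF J, of ?H] by simp
  finally show ?thesis
    by (simp add: power2_eq_square)
qed

lemma dim_stiefel_tangent_le:
  fixes X :: "complex^'r^'n"
  assumes X: "X \<in> Stiefel"
  shows "dim (stiefel_tangent X) + CARD('r)^2 \<le> 2 * CARD('n) * CARD('r)"
proof -
  let ?H = "{S :: complex^'r^'r. ctranspose S = S}"
  let ?N = "(\<lambda>S. X ** S) ` ?H"
  have lin: "linear (\<lambda>S :: complex^'r^'r. X ** S)"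
    by (intro bounded_linear.linear matrix_mult.bounded_linear_right)
  have "inj_on (\<lambda>S :: complex^'r^'r. X ** S) (span ?H)"
    by (rule inj_on_inverseI[of _ "\<lambda>Y. ctranspose X ** Y"])
      (simp add: matrix_mul_assoc StiefelD[OF X])
  then have "dim ?N = dim ?H"
    using lin by (intro dim_image_eq) auto
  moreover have "subspace ?H"
    by (auto simp: subspace_def ctranspose_linear)
  then have "subspace ?N"
    using lin linear_subspace_image by blast
  then have "dim {y \<in> UNIV. \<forall>x\<in>?N. orthogonal x y} + dim ?N = dim (UNIV :: (complex^'r^'n) set)"
    by (intro dim_subspace_orthogonal_to_vectors) auto
  moreover have "stiefel_tangent X \<subseteq> {y \<in> UNIV. \<forall>x\<in>?N. orthogonal x y}"
    by (auto simp: orthogonal_def mult_hermitian_orthogonal_tangent)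
  then have "dim (stiefel_tangent X) \<le> dim {y \<in> UNIV. \<forall>x\<in>?N. orthogonal x y}"
    by (rule dim_subset)
  ultimately show ?thesis
    using dim_hermitian_ge[where 'r = 'r] by simp
qed

text \<open>
  Rank and nullity for the restriction of \<open>L\<close> to \<open>T\<close>: the orthogonal complement of \<open>span B\<close> in \<open>T\<close>
  has the same image as \<open>T\<close>.
\<close>

lemma dim_image_plus_card_kernel_le:
  fixes L :: "'a::euclidean_space \<Rightarrow> 'b::euclidean_space"
  assumes "linear L" "subspace T" "B \<subseteq> T" "independent B" "\<And>b. b \<in> B \<Longrightarrow> L b = 0"
  shows "dim (L ` T) + card B \<le> dim T"
proof -
  define N where "N = {y \<in> T. \<forall>x\<in>span B. orthogonal x y}"
  have sub: "span B \<subseteq> T"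
    using assms by (simp add: span_minimal)
  have L0: "L y = 0" if "y \<in> span B" for y
    using assms(1,5) that by (rule linear_eq_0_on_span)
  have "L ` T \<subseteq> L ` N"
  proof
    fix w assume "w \<in> L ` T"
    then obtain x where x: "x \<in> T" "w = L x" by auto
    obtain y z where yz: "y \<in> span B" "\<And>u. u \<in> span B \<Longrightarrow> orthogonal z u" "x = y + z"
      by (rule orthogonal_subspace_decomp_exists[of B x]) blast
    have "z \<in> T"
      using yz x sub subspace_diff[OF assms(2), of x y] by auto
    then have "z \<in> N"
      using yz(2) by (auto simp: N_def orthogonal_commute)
    moreover have "w = L z"
      using x yz assms(1) L0 by (simp add: linear_add)
    ultimately show "w \<in> L ` N" by auto
  qed
  then have "dim (L ` T) \<le> dim (L ` N)"
    by (rule dim_subset)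
  also have "\<dots> \<le> dim N"
    using assms(1) by (rule dim_image_le)
  finally have "dim (L ` T) \<le> dim N" .
  moreover have "dim N + dim (span B) = dim T"
    unfolding N_def using assms(2) sub by (intro dim_subspace_orthogonal_to_vectors) auto
  moreover have "dim (span B) = card B"
    using assms(4) by (simp add: dim_eq_card_independent)
  ultimately show ?thesis by simp
qed

section \<open>Phase rotations of columns\<close>

definition phase :: "'r::finite \<Rightarrow> real \<Rightarrow> complex^'r^'r" where
  "phase p t = (\<chi> j k. if j = k then if j = p then cis t else 1 else 0)"

text \<open>
  Here \<open>- \<Omega>\<^sub>p \<Omega>\<^sub>p\<close> is the matrix unit \<open>e\<^sub>p e\<^sub>p\<^sup>T\<close>. In this form the dependence on \<open>t\<close> can be differentiated
  without going to entries.
\<close>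

lemma phase_eq: "phase p t = mat 1 + (cos t - 1) *\<^sub>R - (Omega p ** Omega p) + sin t *\<^sub>R Omega p"
proof -
  have "(Omega p ** Omega p) $ j $ k = - (axis p 1 $ j * axis p 1 $ k)" for j k
  proof -
    have "(Omega p ** Omega p) $ j $ k =
        (\<Sum>l\<in>UNIV. if l = p then - (axis p 1 $ j * axis p 1 $ k) else 0)"
      unfolding matrix_matrix_mult_def vec_lambda_beta
      by (intro sum.cong) (auto simp: Omega_def axis_def)
    then show ?thesis by simp
  qed
  then show ?thesis
    by (auto simp: phase_def Omega_def vec_eq_iff mat_def axis_def complex_eq_iff)
qed

lemma unimodular_diagonal_phase: "unimodular_diagonal (phase p t)"
  by (simp add: unimodular_diagonal_def phase_def)

lemma unimodular_diagonal_unitary: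
  assumes "unimodular_diagonal R"
  shows "ctranspose R ** R = mat 1"
proof -
  have "(\<Sum>k\<in>UNIV. cnj (R $ k $ i) * R $ k $ j) = (if i = j then 1 else 0)" for i j
  proof -
    have "(\<Sum>k\<in>UNIV. cnj (R $ k $ i) * R $ k $ j) =
        (\<Sum>k\<in>UNIV. if k = i then cnj (R $ i $ i) * R $ i $ j else 0)"
      using assms by (intro sum.cong) (auto simp: unimodular_diagonal_def)
    also have "\<dots> = cnj (R $ i $ i) * R $ i $ j"
      by simp
    also have "\<dots> = (if i = j then 1 else 0)"
      using assms complex_norm_square[of "R $ i $ i"]
      by (auto simp: unimodular_diagonal_def mult.commute)
    finally show ?thesis .
  qed
  then show ?thesis
    by (simp add: vec_eq_iff matrix_matrix_mult_def ctranspose_def mat_def)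
qed

lemma unimodular_diagonal_ctranspose:
  "unimodular_diagonal R \<Longrightarrow> unimodular_diagonal (ctranspose R)"
  by (auto simp: unimodular_diagonal_def ctranspose_def)

lemma phase_curve_in_Stiefel:
  assumes X: "X \<in> Stiefel"
  shows "curve_in Stiefel X (\<lambda>t. X ** phase p t) (X ** Omega p)"
proof -
  let ?P' = "\<lambda>s. sin s *\<^sub>R (Omega p ** Omega p) + cos s *\<^sub>R Omega p"
  have "(phase p has_vector_derivative ?P' s) (at s)" for s
    unfolding phase_eq[abs_def]
    by (auto intro!: derivative_eq_intros)
  then have der: "((\<lambda>t. X ** phase p t) has_vector_derivative X ** ?P' s) (at s)" for s
    by (rule bounded_linear.has_vector_derivative[OF matrix_mult.bounded_linear_right])
  have "continuous_on {-1<..<1} (\<lambda>s. X ** ?P' s)"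
    by (intro matrix_mult.continuous_on continuous_intros)
  then have "(\<lambda>t. X ** phase p t) C1_differentiable_on {-1<..<1}"
    using der unfolding C1_differentiable_on_def by (intro exI[of _ "\<lambda>s. X ** ?P' s"]) simp
  moreover have "phase p 0 = mat 1"
    by (simp add: phase_eq)
  moreover have "X ** phase p t \<in> Stiefel" for t
    by (simp add: X mult_unitary_in_Stiefel unimodular_diagonal_phase unimodular_diagonal_unitary)
  ultimately show ?thesis
    unfolding curve_in_def using der[of 0] by (auto intro!: exI[of _ 1])
qed

lemma inner_Omega: "Omega p \<bullet> Omega q = (if p = q then 1 else 0)"
proof -
  have "Omega p \<bullet> Omega q = (\<Sum>i\<in>UNIV. \<Sum>j\<in>UNIV. if i = p then if j = p then if p = q then 1 else 0 else 0 else 0)"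
    unfolding inner_vec_def
    by (intro sum.cong) (auto simp: Omega_def axis_def)
  also have "\<dots> = (\<Sum>i\<in>UNIV. if i = p then (if p = q then 1 else 0) else 0)"
    by (intro sum.cong) auto
  also have "\<dots> = (if p = q then 1 else 0)"
    by simp
  finally show ?thesis .
qed

section \<open>Gradient and Hessian on the Stiefel manifold\<close>

lemma curve_in_mult_right:
  assumes c: "curve_in Stiefel X c v" and Q: "ctranspose Q ** Q = mat 1"
  shows "curve_in Stiefel (X ** Q) (\<lambda>t. c t ** Q) (v ** Q)"
proof -
  obtain e where e: "e > 0" "c ` {-e<..<e} \<subseteq> Stiefel" "c C1_differentiable_on {-e<..<e}"
    and c0: "c 0 = X" "(c has_vector_derivative v) (at 0)"
    using c unfolding curve_in_def by blast
  obtain D where D: "\<And>s. s \<in> {-e<..<e} \<Longrightarrow> (c has_vector_derivative D s) (at s)"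
      "continuous_on {-e<..<e} D"
    using e(3) unfolding C1_differentiable_on_def by blast
  note der = bounded_linear.has_vector_derivative[OF matrix_mult.bounded_linear_left]
  have "(\<lambda>t. c t ** Q) C1_differentiable_on {-e<..<e}"
    unfolding C1_differentiable_on_def
    by (intro exI[of _ "\<lambda>s. D s ** Q"] conjI ballI der D matrix_mult.continuous_on continuous_on_const)
  moreover have "(\<lambda>t. c t ** Q) ` {-e<..<e} \<subseteq> Stiefel"
    using e(2) mult_unitary_in_Stiefel[OF _ Q] by auto
  ultimately show ?thesis
    unfolding curve_in_def using e(1) c0 der[OF c0(2)] by auto
qed

text \<open>
  A curve through \<open>U R\<close> becomes, after multiplication by \<open>R\<^sup>H\<close>, a curve through \<open>U\<close> along which \<open>h\<close>
  takes the same values.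
\<close>

lemma riem_grad_vanishes_on_orbit:
  fixes h :: "complex^'r^'n \<Rightarrow> real"
  assumes inv: "scale_invariant h" and U: "U \<in> Stiefel" and R: "unimodular_diagonal R"
    and crit: "\<And>c v. curve_in Stiefel U c v \<Longrightarrow> ((\<lambda>t. h (c t)) has_real_derivative 0) (at 0)"
  shows "riem_grad Stiefel h (U ** R) = 0"
proof (rule riem_gradI)
  have unit: "ctranspose R ** R = mat 1" "R ** ctranspose R = mat 1"
    using unimodular_diagonal_unitary[OF R] unimodular_diagonal_unitary[OF unimodular_diagonal_ctranspose[OF R]]
    by auto
  have UR: "U ** R \<in> Stiefel"
    using U unit(1) by (rule mult_unitary_in_Stiefel)
  show T: "subspace (tangent_space Stiefel (U ** R))"
    by (simp add: UR tangent_space_Stiefel subspace_stiefel_tangent)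
  show "0 \<in> tangent_space Stiefel (U ** R)"
    using T by (rule subspace_0)
  fix c v assume c: "curve_in Stiefel (U ** R) c v"
  have "curve_in Stiefel U (\<lambda>t. c t ** ctranspose R) (v ** ctranspose R)"
    using curve_in_mult_right[OF c, of "ctranspose R"] unit
    by (simp flip: matrix_mul_assoc)
  then have "((\<lambda>t. h (c t ** ctranspose R)) has_real_derivative 0) (at 0)"
    by (rule crit)
  moreover have ev: "\<forall>\<^sub>F t in nhds 0. h (c t ** ctranspose R) = h (c t)"
    using curve_in_eventually[OF c open_UNIV UNIV_I]
    by eventually_elim (use inv unimodular_diagonal_ctranspose[OF R] in \<open>auto simp: scale_invariant_def\<close>)
  ultimately show "((\<lambda>t. h (c t)) has_real_derivative 0 \<bullet> v) (at 0)"
    by (subst (asm) DERIV_cong_ev[OF refl ev refl]) simp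
qed

text \<open>
  The Riemannian gradient is the tangential part of the gradient \<open>G\<close> of an extension. The second
  conclusion states that it represents the differential, which cannot be read off from a definite
  description without knowing that it denotes.
\<close>

lemma riem_grad_eq_stiefel_proj:
  fixes h :: "complex^'r^'n \<Rightarrow> real"
  assumes X: "X \<in> Stiefel" and W: "open W" "X \<in> W"
    and hf: "\<And>Y. Y \<in> W \<inter> Stiefel \<Longrightarrow> h Y = f Y"
    and f: "(f has_derivative f') (at X)"
    and G: "\<And>v. f' v = G \<bullet> v"
  shows "riem_grad Stiefel h X = stiefel_proj X G"
    and "curve_in Stiefel X c v \<Longrightarrow>
      ((\<lambda>t. h (c t)) has_real_derivative stiefel_proj X G \<bullet> v) (at 0)"
proof -
  note T = tangent_space_Stiefel[OF X]
  have der: "((\<lambda>t. h (c t)) has_real_derivative stiefel_proj X G \<bullet> v) (at 0)"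
    if c: "curve_in Stiefel X c v" for c v
  proof -
    have "v \<in> stiefel_tangent X"
      using c T by (auto simp: tangent_space_def)
    then have "f' v = stiefel_proj X G \<bullet> v"
      using stiefel_proj_residual_orthogonal[of v X G] by (simp add: G inner_diff_left)
    then show ?thesis
      using has_vector_derivative_along_curve[where H = h, OF c W hf f]
      by (simp add: has_real_derivative_iff_has_vector_derivative)
  qed
  then show "riem_grad Stiefel h X = stiefel_proj X G"
    by (intro riem_gradI) (simp_all add: T subspace_stiefel_tangent stiefel_proj_in_tangent X)
  show "((\<lambda>t. h (c t)) has_real_derivative stiefel_proj X G \<bullet> v) (at 0)"
    if "curve_in Stiefel X c v"
    using that by (rule der)
qed

text \<open>
  Passes from derivatives as linear functionals to gradient vectors, which the projection acts on.
\<close>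

lemma C2_extension_gradient:
  fixes h :: "'a::euclidean_space \<Rightarrow> real"
  assumes "C2_on_submanifold h M" "x \<in> M"
  obtains W f G G' where "open W" "x \<in> W" "\<And>y. y \<in> W \<inter> M \<Longrightarrow> h y = f y"
    "\<And>y. y \<in> W \<Longrightarrow> (f has_derivative (\<lambda>v. G y \<bullet> v)) (at y)"
    "(G has_derivative G') (at x)"
proof -
  obtain W f where W: "open W" "x \<in> W" "C2_on f W" "\<And>y. y \<in> W \<inter> M \<Longrightarrow> h y = f y"
    using assms unfolding C2_on_submanifold_def by metis
  obtain f' :: "'a \<Rightarrow> 'a \<Rightarrow>\<^sub>L real" and f'' where
    f: "\<And>y. y \<in> W \<Longrightarrow> (f has_derivative blinfun_apply (f' y)) (at y)"
    "(f' has_derivative blinfun_apply (f'' x)) (at x)"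
    using W(2,3) unfolding C2_on_def by blast
  define G where "G y = (\<Sum>b\<in>Basis. f' y b *\<^sub>R b)" for y
  have "blinfun_apply (f' y) v = G y \<bullet> v" for y v
  proof -
    have "blinfun_apply (f' y) v = blinfun_apply (f' y) (\<Sum>b\<in>Basis. (v \<bullet> b) *\<^sub>R b)"
      by (simp add: euclidean_representation)
    also have "\<dots> = G y \<bullet> v"
      by (simp add: G_def inner_sum_left inner_sum_right blinfun.bilinear_simps blinfun.sum_right inner_commute mult.commute)
    finally show ?thesis .
  qed
  then have "blinfun_apply (f' y) = (\<lambda>v. G y \<bullet> v)" for y
    by blast
  moreover have "(G has_derivative (\<lambda>v. \<Sum>b\<in>Basis. f'' x v b *\<^sub>R b)) (at x)"
    unfolding G_def
    by (auto intro!: derivative_eq_intros f(2))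
  ultimately show ?thesis
    by (intro that[OF W(1,2,4)]) (use f(1) in auto)
qed

lemma derivative_along_curve_eq_riem_grad:
  fixes h :: "complex^'r^'n \<Rightarrow> real"
  assumes h: "C2_on_submanifold h Stiefel" and X: "X \<in> Stiefel"
    and c: "curve_in Stiefel X c v"
  shows "((\<lambda>t. h (c t)) has_real_derivative riem_grad Stiefel h X \<bullet> v) (at 0)"
proof -
  obtain W f G G' where W: "open W" "X \<in> W" and hf: "\<And>Y. Y \<in> W \<inter> Stiefel \<Longrightarrow> h Y = f Y"
    and f: "\<And>Y. Y \<in> W \<Longrightarrow> (f has_derivative (\<lambda>v. G Y \<bullet> v)) (at Y)"
    using C2_extension_gradient[OF h X] by metis
  show ?thesis
    using riem_grad_eq_stiefel_proj[where h = h, OF X W hf f[OF W(2)] refl] c by simp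
qed

text \<open>
  By the projection formula, \<open>riem_grad\<close> is near \<open>U\<close> the restriction of a map that is
  differentiable in the ambient space. A single linear map \<open>D\<close>, the derivative of this map at \<open>U\<close>,
  therefore gives the derivative of the gradient along every curve. Linearity of the Hessian
  comes from here.
\<close>

lemma riem_hess_Stiefel_linear:
  fixes h :: "complex^'r^'n \<Rightarrow> real"
  assumes h: "C2_on_submanifold h Stiefel" and U: "U \<in> Stiefel"
  obtains D where "linear D"
    "\<And>v. v \<in> stiefel_tangent U \<Longrightarrow> riem_hess Stiefel h U v = stiefel_proj U (D v)"
    "\<And>c v. curve_in Stiefel U c v \<Longrightarrow>
      ((\<lambda>t. riem_grad Stiefel h (c t)) has_vector_derivative D v) (at 0)"
proof -
  obtain W f G G' where W: "open W" "U \<in> W" and hf: "\<And>Y. Y \<in> W \<inter> Stiefel \<Longrightarrow> h Y = f Y"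
    and f: "\<And>Y. Y \<in> W \<Longrightarrow> (f has_derivative (\<lambda>v. G Y \<bullet> v)) (at Y)"
    and G: "(G has_derivative G') (at U)"
    using C2_extension_gradient[OF h U] by metis
  obtain D where D: "((\<lambda>Y. stiefel_proj Y (G Y)) has_derivative D) (at U)"
    using has_derivative_stiefel_proj[OF G] by blast
  have gradW: "riem_grad Stiefel h Y = stiefel_proj Y (G Y)" if "Y \<in> W \<inter> Stiefel" for Y
    using that by (intro riem_grad_eq_stiefel_proj(1)[where h = h, OF _ W(1) _ hf f refl]) auto
  show ?thesis
  proof (rule that[of D])
    show "linear D"
      by (rule has_derivative_linear[OF D])
    show "riem_hess Stiefel h U v = stiefel_proj U (D v)" if "v \<in> stiefel_tangent U" for v
      using that gradW
      by (intro riem_hessI[OF _ _ W _ D])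
        (auto simp: tangent_space_Stiefel[OF U] subspace_stiefel_tangent
          stiefel_proj_in_tangent[OF U] stiefel_proj_residual_orthogonal)
    show "((\<lambda>t. riem_grad Stiefel h (c t)) has_vector_derivative D v) (at 0)"
      if "curve_in Stiefel U c v" for c v
      using that W gradW D by (rule has_vector_derivative_along_curve)
  qed
qed

section \<open>The kernel and the rank of the Hessian\<close>

theorem lemma2p2:
  fixes h :: "complex^'r^'n \<Rightarrow> real"
    and U :: "complex^'r^'n"
  assumes "CARD('r) \<le> CARD('n)"
    and "C2_on_submanifold h Stiefel"
    and "scale_invariant h"
    and "stationary_point Stiefel h U"
  shows "(\<forall>p. U ** Omega p \<in> tangent_space Stiefel U \<and>
              riem_hess Stiefel h U (U ** Omega p) = 0) \<and>
         int (riem_hess_rank Stiefel h U)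
           \<le> 2 * int CARD('n) * int CARD('r) - (int CARD('r))^2 - int CARD('r)"
proof -
  have U: "U \<in> Stiefel" and grad0: "riem_grad Stiefel h U = 0"
    using assms(4) by (auto simp: stationary_point_def)
  note T = tangent_space_Stiefel[OF U]
  obtain D where D: "linear D"
    and hess: "\<And>v. v \<in> stiefel_tangent U \<Longrightarrow> riem_hess Stiefel h U v = stiefel_proj U (D v)"
    and grad_der: "\<And>c v. curve_in Stiefel U c v \<Longrightarrow>
      ((\<lambda>t. riem_grad Stiefel h (c t)) has_vector_derivative D v) (at 0)"
    by (rule riem_hess_Stiefel_linear[OF assms(2) U]) blast
  define L where "L v = stiefel_proj U (D v)" for v
  have L: "linear L"
    unfolding L_def using linear_compose[OF D linear_stiefel_proj] by (simp add: o_def)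
  have ZT: "U ** Omega p \<in> stiefel_tangent U" for p
    using phase_curve_in_Stiefel[OF U, of p] T by (auto simp: tangent_space_def)
  have LZ: "L (U ** Omega p) = 0" for p
  proof -
    have "riem_grad Stiefel h (U ** phase p t) = 0" for t
      using derivative_along_curve_eq_riem_grad[OF assms(2) U]
      by (intro riem_grad_vanishes_on_orbit assms U unimodular_diagonal_phase)
        (auto simp: grad0)
    then have "((\<lambda>t. 0) has_vector_derivative D (U ** Omega p)) (at 0)"
      using grad_der[OF phase_curve_in_Stiefel[OF U, of p]] by simp
    then have "D (U ** Omega p) = 0"
      by (rule vector_derivative_unique_at) (rule has_vector_derivative_const)
    then show ?thesis
      by (simp add: L_def linear_0[OF linear_stiefel_proj])
  qed
  let ?Z = "range (\<lambda>p. U ** Omega p)"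
  have inner: "(U ** Omega p) \<bullet> (U ** Omega q) = (if p = q then 1 else 0)" for p q
    by (simp add: inner_matrix_mult_left matrix_mul_assoc StiefelD[OF U] inner_Omega)
  have "inj (\<lambda>p. U ** Omega p)"
  proof (rule injI)
    fix p q assume "U ** Omega p = U ** Omega q"
    then show "p = q"
      using inner[of p q] inner[of p p] by (simp split: if_splits)
  qed
  then have card: "card ?Z = CARD('r)"
    by (simp add: card_image)
  have "independent ?Z"
  proof (rule pairwise_orthogonal_independent)
    show "pairwise orthogonal ?Z"
      by (auto simp: pairwise_def orthogonal_def inner)
    show "0 \<notin> ?Z"
    proof
      assume "0 \<in> ?Z"
      then obtain p where "U ** Omega p = 0"
        by auto
      then show False
        using inner[of p p] by simp
    qed
  qed
  then have "dim (L ` stiefel_tangent U) + card ?Z \<le> dim (stiefel_tangent U)"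
    using ZT LZ by (intro dim_image_plus_card_kernel_le L subspace_stiefel_tangent) auto
  moreover have "riem_hess Stiefel h U ` tangent_space Stiefel U = L ` stiefel_tangent U"
    using hess T by (auto simp: L_def)
  ultimately have "riem_hess_rank Stiefel h U + CARD('r) + CARD('r)^2 \<le> 2 * CARD('n) * CARD('r)"
    using dim_stiefel_tangent_le[OF U] by (simp add: riem_hess_rank_def card)
  then have "int (riem_hess_rank Stiefel h U + CARD('r) + CARD('r)^2) \<le> int (2 * CARD('n) * CARD('r))"
    by (simp only: of_nat_le_iff)
  then show ?thesis
    using ZT LZ hess T by (simp add: L_def)
qed

end
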